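(* For every odd $k\geq5$ and every even $d\geq2$ there exists a bipartite Cayley digraph of order $2(k-1)\left(\frac{d}{2}\right)^{k-1}$, degree $d$ and diameter at most $k$.
   Context: A Cayley digraph $Cay(\Gamma,X)$ of a group $\Gamma$ with respect to a generating set $X$ not containing the identity has vertex set $\Gamma$ and an arc from $u$ to $v$ iff $ux=v$ for some $x\in X$; its degree is $|X|$ and its order is $|\Gamma|$. It is bipartite if its vertex set can be partitioned into two parts such that every arc joins vertices in different parts. The diameter is the maximum directed distance between vertices. *)

theory Defs
  imports "HOL-Algebra.Generated_Groups" "Graph_Theory.Graph_Theory"
begin

definition cayley_generating_set :: "('a, 'b) monoid_scheme \<Rightarrow> 'a set \<Rightarrow> bool" where
  "cayley_generating_set \<Gamma> S \<longleftrightarrow>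
     S \<subseteq> carrier \<Gamma> \<and> \<one>\<^bsub>\<Gamma>\<^esub> \<notin> S \<and> generate \<Gamma> S = carrier \<Gamma>"

definition cayley_digraph :: "('a, 'b) monoid_scheme \<Rightarrow> 'a set \<Rightarrow> ('a, 'a \<times> 'a) pre_digraph" where
  "cayley_digraph \<Gamma> S =
     \<lparr> verts = carrier \<Gamma>,
       arcs = {(u, v). u \<in> carrier \<Gamma> \<and> v \<in> carrier \<Gamma> \<and> (\<exists>x\<in>S. u \<otimes>\<^bsub>\<Gamma>\<^esub> x = v)},
       tail = fst, head = snd \<rparr>"

lemma wf_digraph_cayley_digraph: "wf_digraph (cayley_digraph \<Gamma> S)"
  by unfold_locales (auto simp: cayley_digraph_def)

definition bipartite_digraph :: "('a, 'b) pre_digraph \<Rightarrow> bool" where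
  "bipartite_digraph D \<longleftrightarrow>
     (\<exists>U V. verts D = U \<union> V \<and> U \<inter> V = {} \<and>
        (\<forall>e\<in>arcs D. (tail D e \<in> U \<and> head D e \<in> V) \<or> (tail D e \<in> V \<and> head D e \<in> U)))"

(* With every arc of weight 1, \<mu> u v is the length of a shortest directed walk
   from u to v, and it is infinite if there is none. Hence a diameter bounded by a
   natural number includes strong connectedness. *)
definition diameter :: "('a, 'b) pre_digraph \<Rightarrow> ereal" where
  "diameter D = (SUP u\<in>verts D. SUP v\<in>verts D. wf_digraph.\<mu> D (\<lambda>_. 1) u v)"

end

theory Submission
  imports Defs "HOL-Algebra.Weak_Morphisms"
begin

text \<open>Write \<open>n = k - 1\<close> and \<open>m = d / 2\<close>. In the group \<open>(\<int>\<^sub>m wr \<int>\<^sub>n) \<times> \<int>\<^sub>2\<close> take the \<open>2m\<close>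
  generators that add an arbitrary \<open>a \<in> \<int>\<^sub>m\<close> to the coordinate at the current position, then move
  the position by \<open>1\<close> or \<open>2\<close> and flip the parity. A word of length \<open>n\<close> whose successive positions
  exhaust \<open>\<int>\<^sub>n\<close> can produce every \<open>f \<in> \<int>\<^sub>m\<^sup>n\<close>. The moves \<open>2\<^sup>i 1\<^bsup>n-2i-1\<^esup> 2\<^sup>i b\<close> with \<open>b \<in> {1, 2}\<close>
  visit \<open>0, 2, \<dots>, 2i, 2i+1, \<dots>, n-1, 1, 3, \<dots>, 2i-1\<close>, hence all of \<open>\<int>\<^sub>n\<close>, and end in \<open>2i - 1 + b\<close>.
  So the elements of even parity are exactly the products of \<open>n\<close> generators, and one more
  generator reaches those of odd parity.\<close>

section \<open>Products of a fixed number of generators\<close>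

primrec products :: "('a, 'b) monoid_scheme \<Rightarrow> 'a set \<Rightarrow> nat \<Rightarrow> 'a set" where
  "products G S 0 = {\<one>\<^bsub>G\<^esub>}"
| "products G S (Suc l) = products G S l <#>\<^bsub>G\<^esub> S"

lemma products_SucI:
  "u \<in> products G S l \<Longrightarrow> x \<in> S \<Longrightarrow> u \<otimes>\<^bsub>G\<^esub> x \<in> products G S (Suc l)"
  by (auto simp: set_mult_def)

lemma (in monoid) products_closed:
  assumes "S \<subseteq> carrier G"
  shows "products G S l \<subseteq> carrier G"
  using assms by (induction l) (auto simp: set_mult_def)

lemma (in group) products_subset_generate:
  "products G S l \<subseteq> generate G S"
  by (induction l) (auto simp: set_mult_def intro: generate.intros)

text \<open>\<open>products\<close> grows on the right, as arcs do; prepending serves the elements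
  of odd parity, which are written as a fixed generator times an element of even parity.\<close>

lemma (in monoid) products_Suc_left:
  assumes "S \<subseteq> carrier G" "x \<in> S" "u \<in> products G S l"
  shows "x \<otimes> u \<in> products G S (Suc l)"
  using assms(3)
proof (induction l arbitrary: u)
  case 0
  then show ?case
    using assms by (force simp: set_mult_def)
next
  case (Suc l)
  then obtain v y where v: "v \<in> products G S l" "y \<in> S" "u = v \<otimes> y"
    by (auto simp: set_mult_def)
  then have "x \<otimes> u = (x \<otimes> v) \<otimes> y"
    using assms products_closed[OF assms(1)] m_assoc by (metis subsetD)
  then show ?case
    using products_SucI[OF Suc.IH[OF v(1)] v(2)] by simp
qed

lemma cayley_digraph_simps:
  "verts (cayley_digraph G S) = carrier G"
  "(u, v) \<in> arcs (cayley_digraph G S) \<longleftrightarrow>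
     u \<in> carrier G \<and> v \<in> carrier G \<and> (\<exists>x\<in>S. u \<otimes>\<^bsub>G\<^esub> x = v)"
  "tail (cayley_digraph G S) = fst"
  "head (cayley_digraph G S) = snd"
  by (simp_all add: cayley_digraph_def)

lemma (in group) awalk_products:
  assumes "S \<subseteq> carrier G" "u \<in> carrier G" "x \<in> products G S l"
  shows "\<exists>p. pre_digraph.awalk (cayley_digraph G S) u p (u \<otimes> x) \<and> length p = l"
  using assms(3)
proof (induction l arbitrary: x)
  interpret D: wf_digraph "cayley_digraph G S"
    by (rule wf_digraph_cayley_digraph)
  case 0
  then show ?case
    using assms by (auto simp: D.awalk_Nil_iff cayley_digraph_simps)
next
  interpret D: wf_digraph "cayley_digraph G S"
    by (rule wf_digraph_cayley_digraph)
  case (Suc l)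
  then obtain v y where v: "v \<in> products G S l" "y \<in> S" "x = v \<otimes> y"
    by (auto simp: set_mult_def)
  obtain p where p: "D.awalk u p (u \<otimes> v)" "length p = l"
    using Suc.IH[OF v(1)] by blast
  have c: "v \<in> carrier G" "y \<in> carrier G"
    using v assms(1) products_closed by blast+
  then have "u \<otimes> x = u \<otimes> v \<otimes> y"
    using v assms(2) by (simp add: m_assoc)
  with c v(2) assms(2) have "D.awalk (u \<otimes> v) [(u \<otimes> v, u \<otimes> x)] (u \<otimes> x)"
    by (auto simp: D.awalk_Cons_iff D.awalk_Nil_iff cayley_digraph_simps)
  then have "D.awalk u (p @ [(u \<otimes> v, u \<otimes> x)]) (u \<otimes> x)"
    using p(1) by (rule D.awalk_appendI[rotated])
  then show ?case
    using p(2) by (intro exI[of _ "p @ [(u \<otimes> v, u \<otimes> x)]"]) simp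
qed

text \<open>Left translations preserve arcs, so the distance from \<open>u\<close> to
  \<open>v\<close> depends only on \<open>inv u \<otimes> v\<close>: a word of length
  \<open>l\<close> for that element spells a walk of length \<open>l\<close> from \<open>u\<close>
  to \<open>v\<close>.\<close>

lemma (in group) diameter_cayley_digraph_le:
  assumes "S \<subseteq> carrier G" and "carrier G \<subseteq> (\<Union>l\<le>k. products G S l)"
  shows "diameter (cayley_digraph G S) \<le> ereal (real k)"
  unfolding diameter_def
proof (intro SUP_least)
  interpret D: wf_digraph "cayley_digraph G S"
    by (rule wf_digraph_cayley_digraph)
  fix u v assume "u \<in> verts (cayley_digraph G S)" "v \<in> verts (cayley_digraph G S)"
  then have uv: "u \<in> carrier G" "v \<in> carrier G"
    by (simp_all add: cayley_digraph_simps)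
  then have "inv u \<otimes> v \<in> carrier G"
    by simp
  then obtain l where l: "l \<le> k" "inv u \<otimes> v \<in> products G S l"
    using assms(2) by blast
  moreover have "u \<otimes> (inv u \<otimes> v) = v"
    using uv by (simp flip: m_assoc)
  ultimately obtain p where p: "D.awalk u p v" "length p = l"
    using awalk_products[OF assms(1) uv(1) l(2)] by auto
  have "D.\<mu> (\<lambda>_. 1) u v \<le> D.awalk_cost (\<lambda>_. 1) p"
    by (rule D.min_cost_le_walk_cost[OF p(1)])
  also have "D.awalk_cost (\<lambda>_. 1) p = real l"
    using p(2) by (simp add: D.awalk_cost_def sum_list_triv)
  also have "ereal (real l) \<le> ereal (real k)"
    using l(1) by simp
  finally show "D.\<mu> (\<lambda>_. 1) u v \<le> ereal (real k)" .
qed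

lemma (in group) generate_eq_carrier_if_products:
  assumes "S \<subseteq> carrier G" and "carrier G \<subseteq> (\<Union>l\<le>k. products G S l)"
  shows "generate G S = carrier G"
proof
  show "generate G S \<subseteq> carrier G"
    by (rule generate_incl[OF assms(1)])
  show "carrier G \<subseteq> generate G S"
    using assms(2) products_subset_generate by blast
qed

lemma bipartite_cayley_digraphI:
  assumes "\<And>u x. u \<in> carrier G \<Longrightarrow> x \<in> S \<Longrightarrow> P (u \<otimes>\<^bsub>G\<^esub> x) \<longleftrightarrow> \<not> P u"
  shows "bipartite_digraph (cayley_digraph G S)"
  unfolding bipartite_digraph_def
  by (rule exI[of _ "{u \<in> carrier G. P u}"], rule exI[of _ "{u \<in> carrier G. \<not> P u}"])
    (use assms in \<open>auto simp: cayley_digraph_def\<close>)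

section \<open>Renaming the elements of a group\<close>

lemma image_group_mult:
  assumes "inj_on h (carrier G)" "x \<in> carrier G" "y \<in> carrier G"
  shows "h x \<otimes>\<^bsub>image_group h G\<^esub> h y = h (x \<otimes>\<^bsub>G\<^esub> y)"
  using assms by (simp add: image_group_def)

lemma (in group) image_group_iso:
  assumes "inj_on h (carrier G)"
  shows "h \<in> iso G (image_group h G)"
  using assms by (auto simp: iso_def hom_def bij_betw_def image_group_def)

lemma (in group) group_image_group:
  assumes "inj_on h (carrier G)"
  shows "group (image_group h G)"
  using iso_imp_img_group[OF image_group_iso[OF assms]] by (simp add: image_group_def)

lemma (in group) products_image_group:
  assumes "inj_on h (carrier G)" "S \<subseteq> carrier G"
  shows "products (image_group h G) (h ` S) l = h ` products G S l"
proof (induction l)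
  case 0
  then show ?case by (simp add: image_group_one)
next
  case (Suc l)
  have "h x \<otimes>\<^bsub>image_group h G\<^esub> h y = h (x \<otimes> y)" if "x \<in> products G S l" "y \<in> S" for x y
    using that assms products_closed[OF assms(2)] by (blast intro: image_group_mult)
  then show ?case
    by (auto simp: Suc.IH set_mult_def image_iff)
qed

text \<open>The construction lives on triples, but the goal asks for a group on \<open>nat\<close>;
  an injection of the finite carrier transports everything. \<open>cover\<close> yields both
  generation and the diameter bound.\<close>

lemma (in group) bipartite_cayley_digraph_on_nat:
  assumes fin: "finite (carrier G)"
    and S: "S \<subseteq> carrier G" "\<one> \<notin> S"
    and par: "\<And>u x. u \<in> carrier G \<Longrightarrow> x \<in> S \<Longrightarrow> P (u \<otimes> x) \<longleftrightarrow> \<not> P u"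
    and cover: "carrier G \<subseteq> (\<Union>l\<le>k. products G S l)"
  shows "\<exists>(\<Gamma> :: nat monoid) T. group \<Gamma> \<and> cayley_generating_set \<Gamma> T \<and>
           bipartite_digraph (cayley_digraph \<Gamma> T) \<and> order \<Gamma> = order G \<and> card T = card S \<and>
           diameter (cayley_digraph \<Gamma> T) \<le> ereal (real k)"
proof -
  obtain h :: "'a \<Rightarrow> nat" where h: "inj_on h (carrier G)"
    using finite_imp_inj_to_nat_seg[OF fin] by blast
  define \<Gamma> where "\<Gamma> = image_group h G"
  interpret \<Gamma>: group \<Gamma>
    unfolding \<Gamma>_def by (rule group_image_group[OF h])
  have T: "h ` S \<subseteq> carrier \<Gamma>"
    using S by (auto simp: \<Gamma>_def image_group_carrier)
  have cov: "carrier \<Gamma> \<subseteq> (\<Union>l\<le>k. products \<Gamma> (h ` S) l)"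
    using cover by (fastforce simp: \<Gamma>_def image_group_carrier products_image_group[OF h S(1)])
  have "\<one>\<^bsub>\<Gamma>\<^esub> \<notin> h ` S"
    using S inj_onD[OF h] by (auto simp: \<Gamma>_def image_group_one)
  then have "cayley_generating_set \<Gamma> (h ` S)"
    using T \<Gamma>.generate_eq_carrier_if_products[OF T cov] by (simp add: cayley_generating_set_def)
  moreover have "bipartite_digraph (cayley_digraph \<Gamma> (h ` S))"
  proof (rule bipartite_cayley_digraphI[where P = "\<lambda>y. P (inv_into (carrier G) h y)"])
    fix u x assume "u \<in> carrier \<Gamma>" "x \<in> h ` S"
    then obtain u' x' where "u = h u'" "u' \<in> carrier G" "x = h x'" "x' \<in> S"
      by (auto simp: \<Gamma>_def image_group_carrier)
    then show "P (inv_into (carrier G) h (u \<otimes>\<^bsub>\<Gamma>\<^esub> x)) \<longleftrightarrow> \<not> P (inv_into (carrier G) h u)"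
      using S par h by (auto simp: \<Gamma>_def image_group_mult subset_iff)
  qed
  moreover have "order \<Gamma> = order G"
    by (simp add: order_def \<Gamma>_def image_group_carrier card_image[OF h])
  moreover have "card (h ` S) = card S"
    by (rule card_image[OF inj_on_subset[OF h S(1)]])
  ultimately show ?thesis
    using \<Gamma>.diameter_cayley_digraph_le[OF T cov] \<Gamma>.is_group by blast
qed

section \<open>The group and its generators\<close>

text \<open>In \<open>(f, s, t)\<close>, \<open>s\<close> is the current position and
  \<open>t\<close> the parity. The right factor acts relative to \<open>s\<close>, hence the shift
  of \<open>g\<close>. Extensional functions give each vector a single representative.\<close>

definition wreath :: "int \<Rightarrow> int \<Rightarrow> ((int \<Rightarrow> int) \<times> int \<times> int) monoid" where
  "wreath m n =
     \<lparr> carrier = ({0..<n} \<rightarrow>\<^sub>E {0..<m}) \<times> {0..<n} \<times> {0..<2},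
       monoid.mult = (\<lambda>(f, s, t) (g, s', t').
         (\<lambda>i\<in>{0..<n}. (f i + g ((i - s) mod n)) mod m, (s + s') mod n, (t + t') mod 2)),
       one = (\<lambda>i\<in>{0..<n}. 0, 0, 0) \<rparr>"

definition wreath_gen :: "int \<Rightarrow> int \<Rightarrow> int \<Rightarrow> (int \<Rightarrow> int) \<times> int \<times> int" where
  "wreath_gen n a b = (\<lambda>i\<in>{0..<n}. if i = 0 then a else 0, b, 1)"

definition wreath_gens :: "int \<Rightarrow> int \<Rightarrow> ((int \<Rightarrow> int) \<times> int \<times> int) set" where
  "wreath_gens m n = (\<lambda>(a, b). wreath_gen n a b) ` ({0..<m} \<times> {1, 2})"

lemma wreath_simps:
  "carrier (wreath m n) = ({0..<n} \<rightarrow>\<^sub>E {0..<m}) \<times> {0..<n} \<times> {0..<2}"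
  "(f, s, t) \<otimes>\<^bsub>wreath m n\<^esub> (g, s', t') =
     (\<lambda>i\<in>{0..<n}. (f i + g ((i - s) mod n)) mod m, (s + s') mod n, (t + t') mod 2)"
  "\<one>\<^bsub>wreath m n\<^esub> = (\<lambda>i\<in>{0..<n}. 0, 0, 0)"
  by (simp_all add: wreath_def)

lemma group_wreath:
  assumes "m > 0" "n > 0"
  shows "group (wreath m n)"
proof (rule groupI)
  show "\<one>\<^bsub>wreath m n\<^esub> \<in> carrier (wreath m n)"
    using assms by (auto simp: wreath_simps)
next
  fix x y assume "x \<in> carrier (wreath m n)" "y \<in> carrier (wreath m n)"
  then show "x \<otimes>\<^bsub>wreath m n\<^esub> y \<in> carrier (wreath m n)"
    using assms by (cases x; cases y) (auto simp: wreath_simps)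
next
  fix x y z
  assume "x \<in> carrier (wreath m n)" "y \<in> carrier (wreath m n)" "z \<in> carrier (wreath m n)"
  then show "x \<otimes>\<^bsub>wreath m n\<^esub> y \<otimes>\<^bsub>wreath m n\<^esub> z = x \<otimes>\<^bsub>wreath m n\<^esub> (y \<otimes>\<^bsub>wreath m n\<^esub> z)"
    using assms
    by (cases x; cases y; cases z)
      (auto simp: wreath_simps fun_eq_iff mod_simps add.assoc diff_diff_eq)
next
  fix x assume "x \<in> carrier (wreath m n)"
  then obtain f s t where x: "x = (f, s, t)" "f \<in> {0..<n} \<rightarrow>\<^sub>E {0..<m}" "s \<in> {0..<n}" "t \<in> {0..<2}"
    by (auto simp: wreath_simps)
  have "f i mod m = f i" if "0 \<le> i" "i < n" for i
    using PiE_mem[OF x(2), of i] that by simp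
  moreover have "f i = undefined" if "\<not> (0 \<le> i \<and> i < n)" for i
    using PiE_arb[OF x(2), of i] that by auto
  ultimately show "\<one>\<^bsub>wreath m n\<^esub> \<otimes>\<^bsub>wreath m n\<^esub> x = x"
    using x by (auto simp: wreath_simps fun_eq_iff)
  show "\<exists>y\<in>carrier (wreath m n). y \<otimes>\<^bsub>wreath m n\<^esub> x = \<one>\<^bsub>wreath m n\<^esub>"
    using assms
    \<comment> \<open>With \<open>(- s) mod n\<close> as left position, coordinate \<open>i\<close>
      of the product receives \<open>f ((i + s) mod n)\<close>, which the witness has to
      cancel.\<close>
    by (intro bexI[of _ "(\<lambda>i\<in>{0..<n}. (- f ((i + s) mod n)) mod m, (- s) mod n, (- t) mod 2)"])
      (auto simp: x(1) wreath_simps fun_eq_iff mod_simps)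
qed

lemma order_wreath:
  assumes "n \<ge> 0"
  shows "order (wreath m n) = 2 * nat n * nat m ^ nat n"
  using assms by (simp add: order_def wreath_simps card_cartesian_product card_PiE)

text \<open>\<open>n > 2\<close> makes the move by \<open>2\<close> a legal position in
  \<open>{0..<n}\<close>.\<close>

lemma wreath_gens_subset:
  assumes "n > 2"
  shows "wreath_gens m n \<subseteq> carrier (wreath m n)"
  using assms by (auto simp: wreath_gens_def wreath_gen_def wreath_simps)

lemma card_wreath_gens:
  assumes "n > 0"
  shows "card (wreath_gens m n) = 2 * nat m"
proof -
  have "inj_on (\<lambda>(a, b). wreath_gen n a b) ({0..<m} \<times> {1, 2})"
  proof (rule inj_onI, clarify)
    fix a b a' b'
    assume eq: "wreath_gen n a b = wreath_gen n a' b'"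
    \<comment> \<open>Coordinate \<open>0\<close> recovers \<open>a\<close>; the position component
      recovers \<open>b\<close>.\<close>
    then have "fst (wreath_gen n a b) 0 = fst (wreath_gen n a' b') 0"
      by simp
    then show "a = a' \<and> b = b'"
      using eq assms by (simp add: wreath_gen_def)
  qed
  then show ?thesis
    by (simp add: wreath_gens_def card_image card_cartesian_product)
qed

text \<open>Invariant of the walk: visited coordinates already hold their final value, all others
  are \<open>0\<close>. By injectivity no coordinate is written twice. The end position
  \<open>Y l\<close> may repeat an earlier one, as nothing is written there.\<close>

lemma wreath_walk:
  fixes Y :: "nat \<Rightarrow> int"
  assumes n: "n > 2" and m: "m > 0"
    and f: "f \<in> {0..<n} \<rightarrow>\<^sub>E {0..<m}"
    and Y0: "Y 0 = 0"
    and step: "\<And>t. t < l \<Longrightarrow> Y (Suc t) - Y t \<in> {1, 2}"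
    and inj: "inj_on (\<lambda>t. Y t mod n) {..<l}"
    and j: "j \<le> l"
  shows "(\<lambda>i\<in>{0..<n}. if i \<in> (\<lambda>t. Y t mod n) ` {..<j} then f i else 0, Y j mod n, int j mod 2)
           \<in> products (wreath m n) (wreath_gens m n) j"
  using j
proof (induction j)
  case 0
  then show ?case
    by (simp add: wreath_simps Y0 restrict_def)
next
  case (Suc j)
  let ?V = "\<lambda>j. (\<lambda>t. Y t mod n) ` {..<j}"
  \<comment> \<open>The next generator writes the wanted value at the current position and then
    makes the prescribed move.\<close>
  let ?a = "f (Y j mod n)" and ?b = "Y (Suc j) - Y j"
  have a: "?a \<in> {0..<m}"
    using n by (intro PiE_mem[OF f]) simp
  have new: "Y t mod n \<noteq> Y j mod n" if "t < j" for t
    using inj_onD[OF inj, of t j] Suc.prems that by auto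
  \<comment> \<open>Coordinate \<open>0\<close> of the generator, the only one that can be nonzero,
    lands exactly on the current position.\<close>
  have shift: "n dvd i - Y j \<longleftrightarrow> i = Y j mod n" if "0 \<le> i" "i < n" for i
    using that n mod_eq_dvd_iff[of i n "Y j"] by simp
  have fmod: "f i mod m = f i" if "0 \<le> i" "i < n" for i
    using PiE_mem[OF f, of i] that by simp
  have "wreath_gen n ?a ?b \<in> wreath_gens m n"
    unfolding wreath_gens_def using a step[of j] Suc.prems by auto
  then have "(\<lambda>i\<in>{0..<n}. if i \<in> ?V j then f i else 0, Y j mod n, int j mod 2)
      \<otimes>\<^bsub>wreath m n\<^esub> wreath_gen n ?a ?b \<in> products (wreath m n) (wreath_gens m n) (Suc j)"
    using products_SucI[OF Suc.IH[OF Suc_leD[OF Suc.prems]]] by blast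
  moreover have "(\<lambda>i\<in>{0..<n}. if i \<in> ?V j then f i else 0, Y j mod n, int j mod 2)
      \<otimes>\<^bsub>wreath m n\<^esub> wreath_gen n ?a ?b
      = (\<lambda>i\<in>{0..<n}. if i \<in> ?V (Suc j) then f i else 0, Y (Suc j) mod n, int (Suc j) mod 2)"
    using n
    by (auto simp: wreath_gen_def wreath_simps fun_eq_iff shift fmod lessThan_Suc mod_simps
        add.commute dest: new new[symmetric])
  ultimately show ?case by metis
qed

text \<open>The moves \<open>2\<^sup>i 1\<^bsup>n-2i-1\<^esup> 2\<^sup>i b\<close>, with positions not yet reduced modulo \<open>n\<close>.\<close>

definition sweep :: "nat \<Rightarrow> nat \<Rightarrow> int \<Rightarrow> nat \<Rightarrow> int" where
  "sweep n i b t =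
     (if t \<le> i then 2 * int t
      else if t \<le> n - i - 1 then int t + int i
      else if t < n then 2 * int t - int n + 2 * int i + 1
      else int n + 2 * int i - 1 + b)"

lemma sweep_step:
  assumes "2 * i < n" "b \<in> {1, 2}" "t < n"
  shows "sweep n i b (Suc t) - sweep n i b t \<in> {1, 2}"
  using assms by (auto simp: sweep_def)

text \<open>The three cases match the three phases: double steps over the even residues below
  \<open>2 * i\<close>, unit steps from \<open>2 * i\<close> to \<open>n - 1\<close>, and, after
  wrapping around, double steps over the odd residues below \<open>2 * i\<close>.\<close>

lemma sweep_surj:
  assumes "2 * i < n"
  shows "{0..<int n} \<subseteq> (\<lambda>t. sweep n i b t mod int n) ` {..<n}"
proof
  fix r assume "r \<in> {0..<int n}"
  then have r: "0 \<le> r" "r < int n" by auto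
  consider "r < 2 * int i" "even r" | "2 * int i \<le> r" | "r < 2 * int i" "odd r"
    by linarith
  then show "r \<in> (\<lambda>t. sweep n i b t mod int n) ` {..<n}"
  proof cases
    case 1
    then have "sweep n i b (nat (r div 2)) mod int n = r" "nat (r div 2) < n"
      using r by (auto simp: sweep_def)
    then show ?thesis by force
  next
    case 2
    then have "sweep n i b (nat r - i) = r" "nat r - i < n"
      using r by (auto simp: sweep_def)
    then show ?thesis using r by force
  next
    case 3
    then obtain q where q: "r = 2 * q + 1" by (elim oddE)
    \<comment> \<open>Solution of \<open>2 * t - n + 2 * i + 1 = r + n\<close>, the third phase of
      \<open>sweep\<close>.\<close>
    define t where "t = n - i + nat q"
    have "sweep n i b t = r + int n" "t < n"
      using r 3 q assms by (auto simp: sweep_def t_def)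
    then show ?thesis using r by (intro image_eqI[of _ _ t]) auto
  qed
qed

lemma even_wreath_products:
  assumes n: "n > 2" "even n" and m: "m > 0"
    and x: "(f, s, 0) \<in> carrier (wreath m (int n))"
  shows "(f, s, 0) \<in> products (wreath m (int n)) (wreath_gens m (int n)) n"
proof -
  have f: "f \<in> {0..<int n} \<rightarrow>\<^sub>E {0..<m}" and s: "0 \<le> s" "s < int n"
    using x by (auto simp: wreath_simps)
  \<comment> \<open>The sweep ends in \<open>2 * i - 1 + b\<close> modulo \<open>n\<close>; this
    choice makes it \<open>s\<close>, with \<open>b = 1\<close> for even \<open>s\<close> and
    \<open>b = 2\<close> for odd \<open>s\<close>.\<close>
  define i b where "i = nat (s div 2)" and "b = 1 + s mod 2"
  have b: "b \<in> {1, 2}" "2 * int i - 1 + b = s"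
    using s by (auto simp: i_def b_def)
  have i: "2 * i < n"
    using b s by auto
  let ?Y = "sweep n i b"
  have surj: "{0..<int n} \<subseteq> (\<lambda>t. ?Y t mod int n) ` {..<n}"
    by (rule sweep_surj[OF i])
  \<comment> \<open>The \<open>n\<close> times cover \<open>n\<close> residues, so by counting no
    residue is visited twice.\<close>
  have "card {..<n} \<le> card ((\<lambda>t. ?Y t mod int n) ` {..<n})"
    using card_mono[OF _ surj] by simp
  then have inj: "inj_on (\<lambda>t. ?Y t mod int n) {..<n}"
    by (intro eq_card_imp_inj_on antisym card_image_le) simp_all
  have "(\<lambda>j\<in>{0..<int n}. if j \<in> (\<lambda>t. ?Y t mod int n) ` {..<n} then f j else 0,
          ?Y n mod int n, int n mod 2) \<in> products (wreath m (int n)) (wreath_gens m (int n)) n"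
    using n m f sweep_step[OF i b(1)] inj by (intro wreath_walk) (auto simp: sweep_def)
  moreover have "(\<lambda>j\<in>{0..<int n}. if j \<in> (\<lambda>t. ?Y t mod int n) ` {..<n} then f j else 0) = f"
    using surj f by (auto simp: fun_eq_iff PiE_def extensional_def)
  moreover have "?Y n = s + int n"
    using b i by (auto simp: sweep_def)
  then have "?Y n mod int n = s"
    using s by simp
  \<comment> \<open>Here the oddness of \<open>k = n + 1\<close> enters: a word of length
    \<open>n\<close> has parity \<open>0\<close>.\<close>
  moreover have "int n mod 2 = 0"
    using n(2) by simp
  ultimately show ?thesis by metis
qed

lemma carrier_wreath_subset_products:
  assumes n: "n > 2" "even n" and m: "m > 0"
  shows "carrier (wreath m (int n))
           \<subseteq> (\<Union>l\<le>Suc n. products (wreath m (int n)) (wreath_gens m (int n)) l)"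
proof
  let ?G = "wreath m (int n)" and ?S = "wreath_gens m (int n)"
  interpret G: group ?G
    using n m by (intro group_wreath) auto
  have S: "?S \<subseteq> carrier ?G"
    using n by (intro wreath_gens_subset) simp
  fix x assume x: "x \<in> carrier ?G"
  obtain f s t where x_eq: "x = (f, s, t)" by (cases x)
  have "t \<in> {0, 1}"
    using x by (auto simp: x_eq wreath_simps)
  then consider "t = 0" | "t = 1" by blast
  then show "x \<in> (\<Union>l\<le>Suc n. products ?G ?S l)"
  proof cases
    case 1
    then have "x \<in> products ?G ?S n"
      using even_wreath_products[OF n m] x x_eq by simp
    then show ?thesis by (intro UN_I[of n]) auto
  next
    case 2
    \<comment> \<open>Splitting off one generator on the left flips the parity, which leaves an
      element of even parity and a total length of \<open>n + 1\<close>.\<close>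
    define g where "g = wreath_gen (int n) 0 1"
    have g: "g \<in> ?S"
      using m by (auto simp: g_def wreath_gens_def)
    define y where "y = inv\<^bsub>?G\<^esub> g \<otimes>\<^bsub>?G\<^esub> x"
    have gc: "g \<in> carrier ?G"
      using g S by blast
    then have y: "y \<in> carrier ?G" "g \<otimes>\<^bsub>?G\<^esub> y = x"
      using x by (simp_all add: y_def flip: G.m_assoc)
    obtain f' s' t' where y': "y = (f', s', t')" by (cases y)
    have "t' \<in> {0, 1}" "(1 + t') mod 2 = 1"
      using y by (auto simp: y' g_def wreath_gen_def wreath_simps x_eq 2)
    then have "t' = 0"
      by auto
    then have "y \<in> products ?G ?S n"
      using even_wreath_products[OF n m] y y' by simp
    then have "x \<in> products ?G ?S (Suc n)"
      using G.products_Suc_left[OF S g] y(2) by metis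
    then show ?thesis by blast
  qed
qed

theorem theorem3:
  fixes k d :: nat
  assumes "odd k" and "k \<ge> 5" and "even d" and "d \<ge> 2"
  shows "\<exists>(\<Gamma> :: nat monoid) (S :: nat set).
           group \<Gamma> \<and> cayley_generating_set \<Gamma> S \<and>
           bipartite_digraph (cayley_digraph \<Gamma> S) \<and>
           order \<Gamma> = 2 * (k - 1) * (d div 2) ^ (k - 1) \<and>
           card S = d \<and>
           diameter (cayley_digraph \<Gamma> S) \<le> ereal (real k)"
proof -
  define n where "n = k - 1"
  define m where "m = int (d div 2)"
  have n: "n > 2" "even n" "Suc n = k" and m: "m > 0"
    using assms by (auto simp: n_def m_def)
  let ?G = "wreath m (int n)" and ?S = "wreath_gens m (int n)"
  interpret G: group ?G
    using n m by (intro group_wreath) auto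
  have "finite (carrier ?G)"
    by (auto simp: wreath_simps intro: finite_PiE)
  moreover have "?S \<subseteq> carrier ?G"
    using n by (intro wreath_gens_subset) simp
  \<comment> \<open>Generators have parity \<open>1\<close> and the identity has parity
    \<open>0\<close>; the same component two-colours the digraph.\<close>
  moreover have "\<one>\<^bsub>?G\<^esub> \<notin> ?S"
    by (auto simp: wreath_gens_def wreath_gen_def wreath_simps)
  moreover have "even (snd (snd (u \<otimes>\<^bsub>?G\<^esub> x))) \<longleftrightarrow> \<not> even (snd (snd u))" if "x \<in> ?S" for u x
    using that by (cases u) (auto simp: wreath_gens_def wreath_gen_def wreath_simps)
  moreover have "carrier ?G \<subseteq> (\<Union>l\<le>k. products ?G ?S l)"
    using carrier_wreath_subset_products[OF n(1,2) m] n(3) by simp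
  ultimately have "\<exists>(\<Gamma> :: nat monoid) T. group \<Gamma> \<and> cayley_generating_set \<Gamma> T \<and>
      bipartite_digraph (cayley_digraph \<Gamma> T) \<and> order \<Gamma> = order ?G \<and> card T = card ?S \<and>
      diameter (cayley_digraph \<Gamma> T) \<le> ereal (real k)"
    by (intro G.bipartite_cayley_digraph_on_nat[where P = "\<lambda>u. even (snd (snd u))"])
  moreover have "order ?G = 2 * (k - 1) * (d div 2) ^ (k - 1)"
    by (simp add: order_wreath n_def m_def)
  moreover have "card ?S = d"
    using n assms(3) by (simp add: card_wreath_gens m_def)
  ultimately show ?thesis by simp
qed

end
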